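(* Let $(X_0,Y_0)\in PPS$ be strongly efficient, with $X_0=(x_{10},\dots,x_{m0})^T$ and $Y_0=(y_{10},\dots,y_{s0})^T$ having strictly positive components. Let $\omega_i\ge 0$ ($i=1,\dots,m$) with $\sum_{i=1}^m\omega_i=m$ and $\delta_r\ge 0$ ($r=1,\dots,s$) with $\sum_{r=1}^s\delta_r=s$ be fixed. Suppose that $(X_0,Y_0)$ is not of the directional smallest scale size in the direction $(\omega_i)$, $(\delta_r)$. Let $\bar\rho(X_0,Y_0)$ and $\underline\rho(X_0,Y_0)$ be, respectively, the supremum and the infimum of $$\frac{\sum_{i=1}^mv_i\omega_ix_{i0}}{\sum_{r=1}^su_r\delta_ry_{r0}}$$ over all $u_r\ge0$ ($r=1,\dots,s$), $v_i\ge0$ ($i=1,\dots,m$), $\mu_0\in\mathbb{R}$ for which this quotient is defined (nonzero denominator) and $$\sum_{r=1}^su_ry_{rj}-\sum_{i=1}^mv_ix_{ij}+\mu_0\le0\ (j=1,\dots,n),\quad \sum_{r=1}^su_ry_{r0}-\sum_{i=1}^mv_ix_{i0}+\mu_0=0,\quad \sum_{i=1}^mv_ix_{i0}=1.$$ For $t>0$ let $\xi^*(t)$ be the maximum of $\beta/t$ over $\beta\in\mathbb{R}$ and $\lambda_j\ge0$ with $\sum_{j=1}^n\lambda_j=1$, $\sum_{j=1}^n\lambda_jx_{ij}\le(1+\omega_it)x_{i0}$ ($i=1,\dots,m$), $\sum_{j=1}^n\lambda_jy_{rj}\ge(1+\delta_r\beta)y_{r0}$ ($r=1,\dots,s$),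 and let $\psi^*(t)$ be the minimum of $\beta/t$ over $\beta\in\mathbb{R}$ and $\lambda_j\ge0$ with $\sum_{j=1}^n\lambda_j=1$, $\sum_{j=1}^n\lambda_jx_{ij}\le(1-\omega_it)x_{i0}$ ($i=1,\dots,m$), $\sum_{j=1}^n\lambda_jy_{rj}\ge(1-\delta_r\beta)y_{r0}$ ($r=1,\dots,s$). Then, for all sufficiently small $t>0$, $$\bar\rho(X_0,Y_0)=\psi^*(t)\quad\text{and}\quad\underline\rho(X_0,Y_0)=\xi^*(t).$$
   Context: Data: input vectors $X_j=(x_{1j},\dots,x_{mj})^T\in\mathbb{R}^m$ and output vectors $Y_j=(y_{1j},\dots,y_{sj})^T\in\mathbb{R}^s$ with nonnegative components, $j=1,\dots,n$. The production possibility set (variable returns to scale) is $$PPS=\Big\{(X,Y)\in\mathbb{R}^m\times\mathbb{R}^s:\ X\ge\sum_{j=1}^n\lambda_jX_j,\ Y\le\sum_{j=1}^n\lambda_jY_j,\ \sum_{j=1}^n\lambda_j=1,\ \lambda_j\ge0\Big\},$$ with componentwise inequalities. A point $(X,Y)\in PPS$ is strongly efficient if there is no $(\bar X,\bar Y)\in PPS$ with $(-\bar X,\bar Y)\ge(-X,Y)$ and $(\bar X,\bar Y)\ne(X,Y)$. For $t,\beta\in\mathbb{R}$ put $\Omega_t=\mathrm{diag}\{1+\omega_1t,\dots,1+\omega_mt\}$ and $\Phi_\beta=\mathrm{diag}\{1+\delta_1\beta,\dots,1+\delta_s\beta\}$. A strongly efficient $(X_0,Y_0)$ is of the directional smallest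 scale size (in the direction $(\omega_i)$, $(\delta_r)$) if $(\Omega_tX_0,\Phi_\beta Y_0)\notin PPS$ for every $\beta\in\mathbb{R}$ and every $t<0$. *)

theory Defs
  imports "HOL-Analysis.Analysis"
begin

(* Inputs, outputs and observed units are indexed by arbitrary finite types 'm, 's, 'n.
   The orders on vectors and on pairs of vectors are the componentwise ones. *)

definition PPS ::
  "('n::finite \<Rightarrow> real^'m::finite) \<Rightarrow> ('n \<Rightarrow> real^'s::finite) \<Rightarrow> ((real^'m) \<times> (real^'s)) set" where
  "PPS X Y = {(A, B). \<exists>l :: 'n \<Rightarrow> real.
      A \<ge> (\<Sum>j\<in>UNIV. l j *\<^sub>R X j) \<and> B \<le> (\<Sum>j\<in>UNIV. l j *\<^sub>R Y j) \<and>
      (\<Sum>j\<in>UNIV. l j) = 1 \<and> (\<forall>j. l j \<ge> 0)}"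

definition strongly_efficient ::
  "('n::finite \<Rightarrow> real^'m::finite) \<Rightarrow> ('n \<Rightarrow> real^'s::finite) \<Rightarrow> real^'m \<Rightarrow> real^'s \<Rightarrow> bool" where
  "strongly_efficient X Y A B \<longleftrightarrow> (A, B) \<in> PPS X Y \<and>
      \<not> (\<exists>A' B'. (A', B') \<in> PPS X Y \<and> (- A', B') \<ge> (- A, B) \<and> (A', B') \<noteq> (A, B))"

definition diag :: "real^'k::finite \<Rightarrow> real^'k^'k" where
  "diag d = (\<chi> i j. if i = j then d $ i else 0)"

definition scaling :: "real^'k::finite \<Rightarrow> real \<Rightarrow> real^'k^'k" where
  "scaling d t = diag (\<chi> i. 1 + d $ i * t)"

definition directional_smallest_scale_size ::
  "('n::finite \<Rightarrow> real^'m::finite) \<Rightarrow> ('n \<Rightarrow> real^'s::finite) \<Rightarrow> real^'m \<Rightarrow> real^'s \<Rightarrow>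
   real^'m \<Rightarrow> real^'s \<Rightarrow> bool" where
  "directional_smallest_scale_size X Y \<omega> \<delta> X0 Y0 \<longleftrightarrow>
     strongly_efficient X Y X0 Y0 \<and>
     (\<forall>\<beta> t. t < 0 \<longrightarrow> (scaling \<omega> t *v X0, scaling \<delta> \<beta> *v Y0) \<notin> PPS X Y)"

definition multiplier_ratios ::
  "('n::finite \<Rightarrow> real^'m::finite) \<Rightarrow> ('n \<Rightarrow> real^'s::finite) \<Rightarrow> real^'m \<Rightarrow> real^'s \<Rightarrow>
   real^'m \<Rightarrow> real^'s \<Rightarrow> real set" where
  "multiplier_ratios X Y \<omega> \<delta> X0 Y0 =
     {(\<Sum>i\<in>UNIV. v $ i * \<omega> $ i * X0 $ i) / (\<Sum>r\<in>UNIV. u $ r * \<delta> $ r * Y0 $ r) | u v \<mu>0.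
        (\<forall>r. u $ r \<ge> 0) \<and> (\<forall>i. v $ i \<ge> 0) \<and>
        (\<Sum>r\<in>UNIV. u $ r * \<delta> $ r * Y0 $ r) \<noteq> 0 \<and>
        (\<forall>j. (\<Sum>r\<in>UNIV. u $ r * Y j $ r) - (\<Sum>i\<in>UNIV. v $ i * X j $ i) + \<mu>0 \<le> 0) \<and>
        (\<Sum>r\<in>UNIV. u $ r * Y0 $ r) - (\<Sum>i\<in>UNIV. v $ i * X0 $ i) + \<mu>0 = 0 \<and>
        (\<Sum>i\<in>UNIV. v $ i * X0 $ i) = 1}"

(* Taken in ereal: supremum and infimum of a real set need not be finite. *)

definition rho_upper ::
  "('n::finite \<Rightarrow> real^'m::finite) \<Rightarrow> ('n \<Rightarrow> real^'s::finite) \<Rightarrow> real^'m \<Rightarrow> real^'s \<Rightarrow>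
   real^'m \<Rightarrow> real^'s \<Rightarrow> ereal" where
  "rho_upper X Y \<omega> \<delta> X0 Y0 = (SUP q\<in>multiplier_ratios X Y \<omega> \<delta> X0 Y0. ereal q)"

definition rho_lower ::
  "('n::finite \<Rightarrow> real^'m::finite) \<Rightarrow> ('n \<Rightarrow> real^'s::finite) \<Rightarrow> real^'m \<Rightarrow> real^'s \<Rightarrow>
   real^'m \<Rightarrow> real^'s \<Rightarrow> ereal" where
  "rho_lower X Y \<omega> \<delta> X0 Y0 = (INF q\<in>multiplier_ratios X Y \<omega> \<delta> X0 Y0. ereal q)"

definition xi_values ::
  "('n::finite \<Rightarrow> real^'m::finite) \<Rightarrow> ('n \<Rightarrow> real^'s::finite) \<Rightarrow> real^'m \<Rightarrow> real^'s \<Rightarrow>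
   real^'m \<Rightarrow> real^'s \<Rightarrow> real \<Rightarrow> real set" where
  "xi_values X Y \<omega> \<delta> X0 Y0 t =
     {\<beta> / t | \<beta> (l :: 'n \<Rightarrow> real).
        (\<forall>j. l j \<ge> 0) \<and> (\<Sum>j\<in>UNIV. l j) = 1 \<and>
        (\<forall>i. (\<Sum>j\<in>UNIV. l j * X j $ i) \<le> (1 + \<omega> $ i * t) * X0 $ i) \<and>
        (\<forall>r. (\<Sum>j\<in>UNIV. l j * Y j $ r) \<ge> (1 + \<delta> $ r * \<beta>) * Y0 $ r)}"

definition psi_values ::
  "('n::finite \<Rightarrow> real^'m::finite) \<Rightarrow> ('n \<Rightarrow> real^'s::finite) \<Rightarrow> real^'m \<Rightarrow> real^'s \<Rightarrow>
   real^'m \<Rightarrow> real^'s \<Rightarrow> real \<Rightarrow> real set" where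
  "psi_values X Y \<omega> \<delta> X0 Y0 t =
     {\<beta> / t | \<beta> (l :: 'n \<Rightarrow> real).
        (\<forall>j. l j \<ge> 0) \<and> (\<Sum>j\<in>UNIV. l j) = 1 \<and>
        (\<forall>i. (\<Sum>j\<in>UNIV. l j * X j $ i) \<le> (1 - \<omega> $ i * t) * X0 $ i) \<and>
        (\<forall>r. (\<Sum>j\<in>UNIV. l j * Y j $ r) \<ge> (1 - \<delta> $ r * \<beta>) * Y0 $ r)}"

(* Relations rather than functions, so that using an optimal value includes its attainment. *)

definition is_maximum :: "real set \<Rightarrow> real \<Rightarrow> bool" where
  "is_maximum S a \<longleftrightarrow> a \<in> S \<and> (\<forall>b\<in>S. b \<le> a)"

definition is_minimum :: "real set \<Rightarrow> real \<Rightarrow> bool" where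
  "is_minimum S a \<longleftrightarrow> a \<in> S \<and> (\<forall>b\<in>S. a \<le> b)"

end

theory Submission
  imports Defs
begin

text \<open>
  Write \<open>a\<close> and \<open>b\<close> for the vectors with components \<open>\<omega> $ i * X0 $ i\<close> and \<open>\<delta> $ r * Y0 $ r\<close>, and let
  \<open>C\<close> be the cone of feasible directions of the production possibility set at \<open>(X0, Y0)\<close>. Since the
  set is polyhedral, \<open>C\<close> is finitely generated, hence closed; every displacement from \<open>(X0, Y0)\<close>
  within the set lies in \<open>C\<close>, and conversely each direction in \<open>C\<close> can be followed for a short
  while (\<open>PPS_displacement_in_production_cone\<close>, \<open>production_cone_feasible\<close>). So for small \<open>t\<close> the
  scale problems are homogeneous: \<open>\<xi>\<close> is the largest \<open>\<beta>\<close> with \<open>(a, \<beta> *\<^sub>R b) \<in> C\<close> and \<open>\<psi>\<close> the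
  smallest \<open>\<gamma>\<close> with \<open>(- a, - (\<gamma> *\<^sub>R b)) \<in> C\<close>, independently of \<open>t\<close>.

  These extrema exist (\<open>boundary_slopes_exist\<close>). Failure of the directional smallest scale size
  provides some \<open>\<gamma>\<close> on the left. Efficiency excludes improving directions from \<open>C\<close>
  (\<open>efficient_no_improving_direction\<close>), which bounds each set by the members of the other one and
  makes \<open>\<psi>\<close> positive; closedness of \<open>C\<close> gives attainment.

  The multipliers are, up to scaling, the functionals \<open>(- v, u)\<close> that are nonpositive on \<open>C\<close>
  (\<open>multiplier_ratios_supporting\<close>). Evaluating one of them at \<open>(a, \<xi> *\<^sub>R b)\<close> and
  \<open>(- a, - (\<psi> *\<^sub>R b))\<close> places its ratio \<open>v \<bullet> a / (u \<bullet> b)\<close> between \<open>\<xi>\<close> and \<open>\<psi>\<close>. Conversely, for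
  \<open>\<gamma> < \<psi>\<close> or \<open>\<beta> > \<xi>\<close> the corresponding direction lies outside \<open>C\<close>, and a hyperplane separating
  it from \<open>C\<close> is a multiplier with ratio above \<open>\<gamma>\<close> or below \<open>\<beta>\<close> (\<open>multiplier_ratio_above\<close>,
  \<open>multiplier_ratio_below\<close>). One obstacle remains: the multiplier obtained for \<open>\<beta>\<close> may have \<open>v = 0\<close>
  and so resist the normalisation \<open>v \<bullet> X0 = 1\<close>. This can happen when \<open>\<xi> = 0\<close>, in which case the
  infimum need not be attained; adding a small multiple of another multiplier repairs it.
\<close>

section \<open>Closed convex cones and the feasible directions of a convex set\<close>

lemma convex_cone_sum:
  assumes "convex_cone C" "finite I" "\<And>i. i \<in> I \<Longrightarrow> f i \<in> C"
  shows "sum f I \<in> C"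
  using assms(2,3)
  by (induction I rule: finite_induct)
     (auto simp: convex_cone_contains_0[OF assms(1)] intro: convex_cone_add[OF assms(1)])

text \<open>A sum of two directions is followed by taking midpoints of doubled steps along the summands.\<close>

lemma convex_cone_feasible_directions:
  fixes P :: "'a::real_vector set"
  assumes P: "convex P" "z \<in> P"
  shows "convex_cone {d. \<exists>e>0. \<forall>\<epsilon>. 0 \<le> \<epsilon> \<and> \<epsilon> \<le> e \<longrightarrow> z + \<epsilon> *\<^sub>R d \<in> P}"
    (is "convex_cone ?F")
  unfolding convex_cone_iff
proof (intro conjI ballI allI impI)
  show "0 \<in> ?F"
    using P(2) by (auto intro: exI[of _ 1])
next
  fix d d'
  assume "d \<in> ?F" "d' \<in> ?F"
  then obtain e e' where e: "e > 0" "\<And>\<epsilon>. 0 \<le> \<epsilon> \<Longrightarrow> \<epsilon> \<le> e \<Longrightarrow> z + \<epsilon> *\<^sub>R d \<in> P"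
    and e': "e' > 0" "\<And>\<epsilon>. 0 \<le> \<epsilon> \<Longrightarrow> \<epsilon> \<le> e' \<Longrightarrow> z + \<epsilon> *\<^sub>R d' \<in> P"
    by auto
  have "z + \<epsilon> *\<^sub>R (d + d') \<in> P" if \<epsilon>: "0 \<le> \<epsilon>" "\<epsilon> \<le> min e e' / 2" for \<epsilon>
  proof -
    have "(1/2) *\<^sub>R (z + (2 * \<epsilon>) *\<^sub>R d) + (1/2) *\<^sub>R (z + (2 * \<epsilon>) *\<^sub>R d') \<in> P"
      using e(2)[of "2 * \<epsilon>"] e'(2)[of "2 * \<epsilon>"] \<epsilon> by (intro convexD[OF P(1)]) auto
    moreover have "(1/2) *\<^sub>R z + (1/2) *\<^sub>R z = z"
      by (simp flip: scaleR_add_left)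
    ultimately show ?thesis
      by (simp add: scaleR_add_right algebra_simps)
  qed
  then show "d + d' \<in> ?F"
    using e(1) e'(1) by (auto intro!: exI[of _ "min e e' / 2"])
next
  fix d and c :: real
  assume "d \<in> ?F" "0 \<le> c"
  then obtain e where e: "e > 0" "\<And>\<epsilon>. 0 \<le> \<epsilon> \<Longrightarrow> \<epsilon> \<le> e \<Longrightarrow> z + \<epsilon> *\<^sub>R d \<in> P"
    by auto
  have "z + \<epsilon> *\<^sub>R (c *\<^sub>R d) \<in> P" if "0 \<le> \<epsilon>" "\<epsilon> \<le> e / (c + 1)" for \<epsilon>
  proof -
    have "\<epsilon> * c \<le> \<epsilon> * (c + 1)" using that by (simp add: algebra_simps)
    also have "\<dots> \<le> e" using that \<open>0 \<le> c\<close> by (simp add: field_simps)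
    finally show ?thesis using e(2)[of "\<epsilon> * c"] that \<open>0 \<le> c\<close> by simp
  qed
  then show "c *\<^sub>R d \<in> ?F"
    using e(1) \<open>0 \<le> c\<close> by (auto intro!: exI[of _ "e / (c + 1)"])
qed

text \<open>The directions that can be followed for a short while form a convex cone, so it is enough to
  test the generators, and for these convexity supplies the whole segment.\<close>

lemma convex_cone_hull_feasible:
  fixes P :: "'a::real_vector set"
  assumes P: "convex P" "z \<in> P" and G: "\<And>g. g \<in> G \<Longrightarrow> z + g \<in> P"
    and d: "d \<in> convex_cone hull G"
  obtains e where "e > 0" "\<And>\<epsilon>. 0 \<le> \<epsilon> \<Longrightarrow> \<epsilon> \<le> e \<Longrightarrow> z + \<epsilon> *\<^sub>R d \<in> P"
proof -
  let ?F = "{d. \<exists>e>0. \<forall>\<epsilon>. 0 \<le> \<epsilon> \<and> \<epsilon> \<le> e \<longrightarrow> z + \<epsilon> *\<^sub>R d \<in> P}"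
  have "z + \<epsilon> *\<^sub>R g \<in> P" if "g \<in> G" "0 \<le> \<epsilon>" "\<epsilon> \<le> 1" for g \<epsilon>
  proof -
    have "(1 - \<epsilon>) *\<^sub>R z + \<epsilon> *\<^sub>R (z + g) \<in> P"
      using that by (intro convexD[OF P(1)] P(2) G) auto
    then show ?thesis by (simp add: algebra_simps)
  qed
  then have "G \<subseteq> ?F"
    by (auto intro!: exI[of _ "1::real"])
  then have "convex_cone hull G \<subseteq> ?F"
    by (intro hull_minimal convex_cone_feasible_directions P)
  then show ?thesis using d that by auto
qed

text \<open>A functional bounded below on a cone is nonnegative there, because a negative value could be
  scaled past the bound; hence the separating hyperplane can be moved to the origin.\<close>

lemma convex_cone_separation:
  fixes C :: "'a::euclidean_space set"
  assumes C: "convex_cone C" "closed C" and w: "w \<notin> C"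
  obtains h where "\<And>x. x \<in> C \<Longrightarrow> h \<bullet> x \<le> 0" "h \<bullet> w > 0"
proof -
  obtain k c where k: "k \<bullet> w < c" "\<forall>x\<in>C. k \<bullet> x > c"
    using separating_hyperplane_closed_point[OF _ C(2) w] C(1)
    by (auto simp: convex_cone_def)
  have c: "c < 0"
    using k(2) convex_cone_contains_0[OF C(1)] by fastforce
  have "k \<bullet> x \<ge> 0" if x: "x \<in> C" for x
  proof (rule ccontr)
    assume "\<not> k \<bullet> x \<ge> 0"
    then have neg: "k \<bullet> x < 0" by simp
    \<comment> \<open>The multiple of \<open>x\<close> on which the functional takes exactly the value \<open>c\<close>.\<close>
    have "(c / (k \<bullet> x)) *\<^sub>R x \<in> C"
      using neg c x by (intro convex_cone_scaleR[OF C(1)]) (auto simp: divide_nonpos_neg)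
    then have "k \<bullet> ((c / (k \<bullet> x)) *\<^sub>R x) > c" using k(2) by blast
    then show False using neg by simp
  qed
  then show ?thesis
    using k(1) c that[of "- k"] by force
qed

section \<open>The section of a closed convex cone by a plane\<close>

text \<open>The cone meets the plane spanned by \<open>(a, 0)\<close> and \<open>(0, b)\<close> in a closed planar cone. If that
  cone contains no direction of improvement, the half-lines bounding it from above have the
  slopes \<open>\<xi>\<close> on the right and \<open>\<psi>\<close> on the left. Both are finite because two directions \<open>(1, \<beta>)\<close> and
  \<open>(-1, -\<gamma>)\<close> add up to \<open>(0, \<beta> - \<gamma>)\<close>, which forces \<open>\<beta> \<le> \<gamma>\<close>.\<close>

lemma boundary_slopes_exist:
  fixes C :: "('a::euclidean_space \<times> 'b::euclidean_space) set"
  assumes C: "convex_cone C" "closed C"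
    and a: "(a, 0) \<in> C" and left: "(- a, - (\<gamma>0 *\<^sub>R b)) \<in> C"
    and eff: "\<And>t \<beta>. (t *\<^sub>R a, \<beta> *\<^sub>R b) \<in> C \<Longrightarrow> t \<le> 0 \<Longrightarrow> 0 \<le> \<beta> \<Longrightarrow> t = 0 \<and> \<beta> = 0"
  obtains \<xi> \<psi> where "is_maximum {\<beta>. (a, \<beta> *\<^sub>R b) \<in> C} \<xi>" "is_minimum {\<gamma>. (- a, - (\<gamma> *\<^sub>R b)) \<in> C} \<psi>"
    "0 \<le> \<xi>" "0 < \<psi>"
proof -
  let ?R = "{\<beta>. (a, \<beta> *\<^sub>R b) \<in> C}" and ?L = "{\<gamma>. (- a, - (\<gamma> *\<^sub>R b)) \<in> C}"
  have le: "\<beta> \<le> \<gamma>" if "\<beta> \<in> ?R" "\<gamma> \<in> ?L" for \<beta> \<gamma>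
  proof -
    have "(0 *\<^sub>R a, (\<beta> - \<gamma>) *\<^sub>R b) \<in> C"
      using convex_cone_add[OF C(1), of "(a, \<beta> *\<^sub>R b)" "(- a, - (\<gamma> *\<^sub>R b))"] that
      by (simp add: algebra_simps)
    then show ?thesis using eff[of 0 "\<beta> - \<gamma>"] by force
  qed
  have R0: "0 \<in> ?R" using a by simp
  have L0: "\<gamma>0 \<in> ?L" using left by simp
  have "closed ((\<lambda>\<beta>. (a, \<beta> *\<^sub>R b)) -` C)" "closed ((\<lambda>\<gamma>. (- a, - (\<gamma> *\<^sub>R b))) -` C)"
    by (intro continuous_closed_vimage C(2) continuous_intros)+
  then have cl: "closed ?R" "closed ?L"
    by (simp_all add: vimage_def)
  have bdd: "bdd_above ?R" "bdd_below ?L"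
    using le R0 L0 unfolding bdd_above_def bdd_below_def by blast+
  have max: "is_maximum ?R (Sup ?R)"
    unfolding is_maximum_def
    using closed_contains_Sup[OF _ bdd(1) cl(1)] R0 cSup_upper[OF _ bdd(1)] by blast
  have min: "is_minimum ?L (Inf ?L)"
    unfolding is_minimum_def
    using closed_contains_Inf[OF _ bdd(2) cl(2)] L0 cInf_lower[OF _ bdd(2)] by blast
  have "0 \<le> Sup ?R"
    using R0 by (intro cSup_upper bdd)
  moreover have "0 < Inf ?L"
  proof (rule ccontr)
    assume "\<not> 0 < Inf ?L"
    moreover have "((-1) *\<^sub>R a, (- Inf ?L) *\<^sub>R b) \<in> C"
      using min by (simp add: is_minimum_def)
    ultimately show False using eff[of "-1" "- Inf ?L"] by simp
  qed
  ultimately show ?thesis using that max min by blast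
qed

section \<open>The cone of feasible directions of the production possibility set\<close>

text \<open>Besides the displacements to the observed units, the generators include the directions of free
  disposal: using more of one input and producing less of one output.\<close>

definition production_cone ::
  "('n::finite \<Rightarrow> real^'m::finite) \<Rightarrow> ('n \<Rightarrow> real^'s::finite) \<Rightarrow> real^'m \<Rightarrow> real^'s \<Rightarrow>
   ((real^'m) \<times> (real^'s)) set" where
  "production_cone X Y X0 Y0 = convex_cone hull
     (range (\<lambda>j. (X j - X0, Y j - Y0)) \<union> range (\<lambda>i. (axis i 1, 0)) \<union> range (\<lambda>r. (0, - axis r 1)))"

lemma convex_cone_production_cone: "convex_cone (production_cone X Y X0 Y0)"
  unfolding production_cone_def by (rule convex_cone_convex_cone_hull)

lemma closed_production_cone: "closed (production_cone X Y X0 Y0)"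
  unfolding production_cone_def by (rule closed_convex_cone_hull) simp

lemma free_disposal_in_production_cone:
  fixes p :: "real^'m::finite" and q :: "real^'s::finite"
  assumes "\<And>i. 0 \<le> p $ i" "\<And>r. 0 \<le> q $ r"
  shows "(p, - q) \<in> production_cone X Y X0 Y0"
proof -
  let ?C = "production_cone X Y X0 Y0"
  have "(\<Sum>i\<in>UNIV. p $ i *\<^sub>R (axis i 1, 0)) + (\<Sum>r\<in>UNIV. q $ r *\<^sub>R (0, - axis r 1)) \<in> ?C"
    using assms unfolding production_cone_def
    by (intro convex_cone_hull_add convex_cone_sum convex_cone_convex_cone_hull convex_cone_hull_mul
          hull_inc) auto
  also have "(\<Sum>i\<in>UNIV. p $ i *\<^sub>R (axis i 1, 0::real^'s)) = (p, 0)"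
    by (simp add: prod_eq_iff fst_sum snd_sum vec_eq_iff axis_def if_distrib cong: if_cong)
  also have "(\<Sum>r\<in>UNIV. q $ r *\<^sub>R (0::real^'m, - axis r 1)) = (0, - q)"
    by (simp add: prod_eq_iff fst_sum snd_sum vec_eq_iff axis_def sum_negf if_distrib cong: if_cong)
  finally show ?thesis by simp
qed

lemma PPS_displacement_in_production_cone:
  assumes "(A, B) \<in> PPS X Y"
  shows "(A - X0, B - Y0) \<in> production_cone X Y X0 Y0"
proof -
  let ?C = "production_cone X Y X0 Y0"
  obtain l where A: "(\<Sum>j\<in>UNIV. l j *\<^sub>R X j) \<le> A" and B: "B \<le> (\<Sum>j\<in>UNIV. l j *\<^sub>R Y j)"
    and l: "(\<Sum>j\<in>UNIV. l j) = 1" "\<And>j. l j \<ge> 0"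
    using assms unfolding PPS_def by blast
  have "(\<Sum>j\<in>UNIV. l j *\<^sub>R (X j - X0, Y j - Y0)) \<in> ?C"
    using l(2) unfolding production_cone_def
    by (intro convex_cone_sum convex_cone_convex_cone_hull convex_cone_hull_mul hull_inc) auto
  moreover have "(A - (\<Sum>j\<in>UNIV. l j *\<^sub>R X j), - ((\<Sum>j\<in>UNIV. l j *\<^sub>R Y j) - B)) \<in> ?C"
    using A B by (intro free_disposal_in_production_cone) (auto simp: less_eq_vec_def)
  ultimately have "(\<Sum>j\<in>UNIV. l j *\<^sub>R (X j - X0, Y j - Y0))
      + (A - (\<Sum>j\<in>UNIV. l j *\<^sub>R X j), - ((\<Sum>j\<in>UNIV. l j *\<^sub>R Y j) - B)) \<in> ?C"
    by (rule convex_cone_add[OF convex_cone_production_cone])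
  moreover have "(\<Sum>j\<in>UNIV. l j *\<^sub>R (X j - X0, Y j - Y0))
      = ((\<Sum>j\<in>UNIV. l j *\<^sub>R X j) - X0, (\<Sum>j\<in>UNIV. l j *\<^sub>R Y j) - Y0)"
    using l(1) by (simp add: prod_eq_iff fst_sum snd_sum scaleR_diff_right sum_subtractf
        flip: scaleR_sum_left)
  ultimately show ?thesis by simp
qed

lemma convex_PPS:
  fixes X :: "'n::finite \<Rightarrow> real^'m::finite" and Y :: "'n \<Rightarrow> real^'s::finite"
  shows "convex (PPS X Y)"
proof (rule convexI)
  fix z z' and c d :: real
  assume "z \<in> PPS X Y" "z' \<in> PPS X Y" and cd: "0 \<le> c" "0 \<le> d" "c + d = 1"
  then obtain l l' where
    l: "(\<Sum>j\<in>UNIV. l j *\<^sub>R X j) \<le> fst z" "snd z \<le> (\<Sum>j\<in>UNIV. l j *\<^sub>R Y j)"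
       "(\<Sum>j\<in>UNIV. l j) = 1" "\<And>j. l j \<ge> 0" and
    l': "(\<Sum>j\<in>UNIV. l' j *\<^sub>R X j) \<le> fst z'" "snd z' \<le> (\<Sum>j\<in>UNIV. l' j *\<^sub>R Y j)"
       "(\<Sum>j\<in>UNIV. l' j) = 1" "\<And>j. l' j \<ge> 0"
    unfolding PPS_def by (auto simp: case_prod_beta)
  let ?l = "\<lambda>j. c * l j + d * l' j"
  have comb: "(\<Sum>j\<in>UNIV. ?l j *\<^sub>R Z j) =
      c *\<^sub>R (\<Sum>j\<in>UNIV. l j *\<^sub>R Z j) + d *\<^sub>R (\<Sum>j\<in>UNIV. l' j *\<^sub>R Z j)" for Z :: "'n \<Rightarrow> real^'k::finite"
    by (simp add: scaleR_add_left sum.distrib scaleR_sum_right)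
  have "(\<Sum>j\<in>UNIV. ?l j *\<^sub>R X j) \<le> c *\<^sub>R fst z + d *\<^sub>R fst z'"
    using l(1) l'(1) cd unfolding comb less_eq_vec_def
    by (auto intro!: add_mono mult_left_mono)
  moreover have "c *\<^sub>R snd z + d *\<^sub>R snd z' \<le> (\<Sum>j\<in>UNIV. ?l j *\<^sub>R Y j)"
    using l(2) l'(2) cd unfolding comb less_eq_vec_def
    by (auto intro!: add_mono mult_left_mono)
  moreover have "(\<Sum>j\<in>UNIV. ?l j) = 1" "\<And>j. ?l j \<ge> 0"
    using l(3,4) l'(3,4) cd by (simp_all add: sum.distrib flip: sum_distrib_left)
  ultimately show "c *\<^sub>R z + d *\<^sub>R z' \<in> PPS X Y"
    unfolding PPS_def by (auto simp: case_prod_beta)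
qed

lemma observed_in_PPS:
  fixes X :: "'n::finite \<Rightarrow> real^'m::finite" and Y :: "'n \<Rightarrow> real^'s::finite"
  shows "(X j, Y j) \<in> PPS X Y"
proof -
  have unit: "(\<Sum>k\<in>UNIV. (if k = j then 1 else 0) *\<^sub>R Z k) = Z j" for Z :: "'n \<Rightarrow> real^'k::finite"
    by (simp add: if_distrib[of "\<lambda>c. c *\<^sub>R _"] cong: if_cong)
  show ?thesis
    unfolding PPS_def by (auto simp: unit intro!: exI[of _ "\<lambda>k. if k = j then 1 else 0"])
qed

lemma PPS_free_disposal:
  assumes "(A, B) \<in> PPS X Y" "A \<le> A'" "B' \<le> B"
  shows "(A', B') \<in> PPS X Y"
  using assms unfolding PPS_def by (auto intro: order_trans)

lemma production_cone_feasible: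
  fixes X :: "'n::finite \<Rightarrow> real^'m::finite" and Y :: "'n \<Rightarrow> real^'s::finite"
  assumes z: "(X0, Y0) \<in> PPS X Y" and d: "d \<in> production_cone X Y X0 Y0"
  obtains e where "e > 0" "\<And>\<epsilon>. 0 \<le> \<epsilon> \<Longrightarrow> \<epsilon> \<le> e \<Longrightarrow> (X0, Y0) + \<epsilon> *\<^sub>R d \<in> PPS X Y"
proof (rule convex_cone_hull_feasible[OF convex_PPS z _ d[unfolded production_cone_def]])
  fix g :: "(real^'m) \<times> (real^'s)"
  assume "g \<in> range (\<lambda>j. (X j - X0, Y j - Y0)) \<union> range (\<lambda>i. (axis i 1, 0)) \<union> range (\<lambda>r. (0, - axis r 1))"
  then show "(X0, Y0) + g \<in> PPS X Y"
    by (auto intro!: observed_in_PPS PPS_free_disposal[OF z] simp: less_eq_vec_def axis_def)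
qed (use that in blast)

text \<open>Small multiples of a feasible direction stay in the set, so a direction that improves an
  efficient point without worsening any component would lead to a point dominating it.\<close>

lemma efficient_no_improving_direction:
  assumes eff: "strongly_efficient X Y X0 Y0"
    and d: "(p, q) \<in> production_cone X Y X0 Y0" and "p \<le> 0" "0 \<le> q"
  shows "p = 0 \<and> q = 0"
proof -
  have z: "(X0, Y0) \<in> PPS X Y" using eff by (simp add: strongly_efficient_def)
  obtain e where e: "e > 0" "(X0, Y0) + e *\<^sub>R (p, q) \<in> PPS X Y"
    using production_cone_feasible[OF z d] by (metis order.refl order.strict_implies_order)
  have "(- (X0 + e *\<^sub>R p), Y0 + e *\<^sub>R q) \<ge> (- X0, Y0)"
    using assms(3,4) e(1)
    by (auto simp: less_eq_prod_def less_eq_vec_def mult_nonneg_nonpos)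
  then have "(X0 + e *\<^sub>R p, Y0 + e *\<^sub>R q) = (X0, Y0)"
    using eff e(2) unfolding strongly_efficient_def add_Pair scaleR_Pair by blast
  then have "e *\<^sub>R p = 0" "e *\<^sub>R q = 0" by (simp_all add: prod_eq_iff)
  then show ?thesis using e(1) by (simp only: scaleR_eq_0_iff) simp
qed

section \<open>Multipliers\<close>

text \<open>These are the pairs for which \<open>(- v, u)\<close> lies in the polar of the production cone. If
  \<open>(X0, Y0)\<close> is feasible, a nonzero pair defines a hyperplane supporting the production possibility
  set there.\<close>

definition supporting_multiplier ::
  "('n::finite \<Rightarrow> real^'m::finite) \<Rightarrow> ('n \<Rightarrow> real^'s::finite) \<Rightarrow> real^'m \<Rightarrow> real^'s \<Rightarrow>
   real^'m \<Rightarrow> real^'s \<Rightarrow> bool" where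
  "supporting_multiplier X Y X0 Y0 v u \<longleftrightarrow>
     (\<forall>i. 0 \<le> v $ i) \<and> (\<forall>r. 0 \<le> u $ r) \<and> (\<forall>j. u \<bullet> (Y j - Y0) \<le> v \<bullet> (X j - X0))"

lemma supporting_multiplier_combination:
  assumes "supporting_multiplier X Y X0 Y0 v u" "supporting_multiplier X Y X0 Y0 v' u'" "0 \<le> c" "0 \<le> d"
  shows "supporting_multiplier X Y X0 Y0 (c *\<^sub>R v + d *\<^sub>R v') (c *\<^sub>R u + d *\<^sub>R u')"
  using assms unfolding supporting_multiplier_def
  by (auto simp: inner_add_left intro!: add_mono mult_left_mono)

lemma supporting_multiplier_production_cone:
  assumes m: "supporting_multiplier X Y X0 Y0 v u" and d: "(p, q) \<in> production_cone X Y X0 Y0"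
  shows "u \<bullet> q \<le> v \<bullet> p"
proof -
  have "production_cone X Y X0 Y0 \<subseteq> {d. (- v, u) \<bullet> d \<le> 0}"
    unfolding production_cone_def using m
    by (intro hull_minimal convex_cone_halfspace_le)
       (auto simp: supporting_multiplier_def inner_axis)
  then show ?thesis using d by auto
qed

text \<open>The signs of \<open>v\<close> and \<open>u\<close> come for free: they are the values of the separating functional on
  the free disposal generators.\<close>

lemma supporting_multiplier_separates:
  assumes "(p, q) \<notin> production_cone X Y X0 Y0"
  obtains v u where "supporting_multiplier X Y X0 Y0 v u" "v \<bullet> p < u \<bullet> q"
proof -
  let ?C = "production_cone X Y X0 Y0"
  obtain h where h: "\<And>d. d \<in> ?C \<Longrightarrow> h \<bullet> d \<le> 0" "h \<bullet> (p, q) > 0"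
    using convex_cone_separation[OF convex_cone_production_cone closed_production_cone assms] by blast
  obtain v u where vu: "h = (- v, u)"
    by (cases h) (metis minus_minus)
  have gen: "d \<in> ?C" if "d \<in> range (\<lambda>j. (X j - X0, Y j - Y0)) \<union> range (\<lambda>i. (axis i 1, 0))
      \<union> range (\<lambda>r. (0, - axis r 1))" for d
    unfolding production_cone_def using that by (rule hull_inc)
  have "0 \<le> v $ i" for i
    using h(1)[OF gen, of "(axis i 1, 0)"] vu by (simp add: inner_axis)
  moreover have "0 \<le> u $ r" for r
    using h(1)[OF gen, of "(0, - axis r 1)"] vu by (simp add: inner_axis)
  moreover have "u \<bullet> (Y j - Y0) \<le> v \<bullet> (X j - X0)" for j
    using h(1)[OF gen, of "(X j - X0, Y j - Y0)"] vu by simp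
  ultimately have "supporting_multiplier X Y X0 Y0 v u"
    by (simp add: supporting_multiplier_def)
  then show ?thesis using that h(2) vu by auto
qed

lemma inner_nonneg_pos_weights:
  fixes v w :: "real^'k::finite"
  assumes "\<And>i. 0 \<le> v $ i" "\<And>i. 0 < w $ i" "v \<noteq> 0"
  shows "0 < v \<bullet> w"
proof -
  obtain i where "v $ i \<noteq> 0" using assms(3) by (auto simp: vec_eq_iff)
  then have "0 < v $ i * w $ i" using assms(1,2)[of i] by simp
  moreover have "0 \<le> v $ k * w $ k" for k
    using assms(1,2)[of k] by simp
  ultimately show ?thesis
    unfolding inner_vec_def by (auto intro!: sum_pos2[of _ i])
qed

lemma inner_nonneg_vec:
  fixes v w :: "real^'k::finite"
  assumes "\<And>i. 0 \<le> v $ i" "\<And>i. 0 \<le> w $ i"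
  shows "0 \<le> v \<bullet> w"
  unfolding inner_vec_def using assms by (auto intro: sum_nonneg)

text \<open>Eliminating the intercept \<open>\<mu>0\<close> turns the constraints into those of a supporting multiplier,
  and the ratio is homogeneous of degree zero, so the normalisation may be relaxed to positivity.\<close>

lemma multiplier_ratios_supporting:
  "multiplier_ratios X Y \<omega> \<delta> X0 Y0 =
     {v \<bullet> (\<chi> i. \<omega> $ i * X0 $ i) / (u \<bullet> (\<chi> r. \<delta> $ r * Y0 $ r)) | v u.
        supporting_multiplier X Y X0 Y0 v u \<and> u \<bullet> (\<chi> r. \<delta> $ r * Y0 $ r) \<noteq> 0 \<and> 0 < v \<bullet> X0}"
    (is "_ = {v \<bullet> ?a / (u \<bullet> ?b) | v u. _ v u}")
proof -
  have expand: "(\<Sum>i\<in>UNIV. v $ i * \<omega> $ i * X0 $ i) = v \<bullet> ?a"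
    "(\<Sum>r\<in>UNIV. u $ r * \<delta> $ r * Y0 $ r) = u \<bullet> ?b" for v u
    by (simp_all add: inner_vec_def mult.assoc)
  have inner: "(\<Sum>i\<in>UNIV. v $ i * w $ i) = v \<bullet> w" for v w :: "real^'k"
    by (simp add: inner_vec_def)
  have "multiplier_ratios X Y \<omega> \<delta> X0 Y0 =
     {v \<bullet> ?a / (u \<bullet> ?b) | v u. supporting_multiplier X Y X0 Y0 v u \<and> u \<bullet> ?b \<noteq> 0 \<and> v \<bullet> X0 = 1}"
      (is "_ = ?N")
  proof (intro equalityI subsetI)
    fix q assume "q \<in> multiplier_ratios X Y \<omega> \<delta> X0 Y0"
    then obtain u v \<mu> where q: "q = v \<bullet> ?a / (u \<bullet> ?b)" "\<forall>r. u $ r \<ge> 0" "\<forall>i. v $ i \<ge> 0"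
      "u \<bullet> ?b \<noteq> 0" "\<forall>j. u \<bullet> Y j - v \<bullet> X j + \<mu> \<le> 0" "u \<bullet> Y0 - v \<bullet> X0 + \<mu> = 0" "v \<bullet> X0 = 1"
      unfolding multiplier_ratios_def expand inner by blast
    then have "u \<bullet> (Y j - Y0) \<le> v \<bullet> (X j - X0)" for j
      by (smt (verit) inner_diff_right)
    then show "q \<in> ?N" using q by (auto simp: supporting_multiplier_def)
  next
    fix q assume "q \<in> ?N"
    then obtain v u where q: "q = v \<bullet> ?a / (u \<bullet> ?b)" "supporting_multiplier X Y X0 Y0 v u"
      "u \<bullet> ?b \<noteq> 0" "v \<bullet> X0 = 1" by blast
    have "\<forall>j. u \<bullet> Y j - v \<bullet> X j + (v \<bullet> X0 - u \<bullet> Y0) \<le> 0"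
      using q(2) unfolding supporting_multiplier_def by (auto simp: inner_diff_right algebra_simps)
    then show "q \<in> multiplier_ratios X Y \<omega> \<delta> X0 Y0"
      unfolding multiplier_ratios_def expand inner using q
      by (auto simp: supporting_multiplier_def intro!: exI[of _ u] exI[of _ v] exI[of _ "v \<bullet> X0 - u \<bullet> Y0"])
  qed
  also have "\<dots> = {v \<bullet> ?a / (u \<bullet> ?b) | v u.
      supporting_multiplier X Y X0 Y0 v u \<and> u \<bullet> ?b \<noteq> 0 \<and> 0 < v \<bullet> X0}" (is "_ = ?S")
  proof (intro equalityI subsetI)
    fix q assume "q \<in> ?S"
    then obtain v u where q: "q = v \<bullet> ?a / (u \<bullet> ?b)" "supporting_multiplier X Y X0 Y0 v u"
      "u \<bullet> ?b \<noteq> 0" "0 < v \<bullet> X0" by blast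
    let ?c = "1 / (v \<bullet> X0)"
    have "supporting_multiplier X Y X0 Y0 (?c *\<^sub>R v) (?c *\<^sub>R u)"
      using supporting_multiplier_combination[OF q(2) q(2), of ?c 0] q(4) by simp
    moreover have "q = (?c *\<^sub>R v) \<bullet> ?a / ((?c *\<^sub>R u) \<bullet> ?b)" "(?c *\<^sub>R u) \<bullet> ?b \<noteq> 0"
      "(?c *\<^sub>R v) \<bullet> X0 = 1"
      using q by simp_all
    ultimately show "q \<in> ?N" by blast
  qed force
  finally show ?thesis .
qed

section \<open>Ratios of multipliers and slopes\<close>

text \<open>Positivity is what needs an argument. If \<open>u \<bullet> b\<close> vanished, the bound coming from \<open>\<psi>\<close> would
  make \<open>v \<bullet> a\<close> nonpositive; and \<open>v \<bullet> a > 0\<close> forces \<open>v \<noteq> 0\<close>, hence \<open>v \<bullet> X0 > 0\<close>.\<close>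

lemma multiplier_ratio_above:
  assumes "\<And>r. 0 \<le> b $ r" and X0: "\<And>i. 0 < X0 $ i"
    and \<psi>: "(- a, - (\<psi> *\<^sub>R b)) \<in> production_cone X Y X0 Y0"
    and \<gamma>: "(- a, - (\<gamma> *\<^sub>R b)) \<notin> production_cone X Y X0 Y0" "0 \<le> \<gamma>"
  obtains v u where "supporting_multiplier X Y X0 Y0 v u" "0 < u \<bullet> b" "0 < v \<bullet> X0"
    "\<gamma> * (u \<bullet> b) < v \<bullet> a"
proof -
  obtain v u where m: "supporting_multiplier X Y X0 Y0 v u"
    and "v \<bullet> (- a) < u \<bullet> (- (\<gamma> *\<^sub>R b))"
    using supporting_multiplier_separates[OF \<gamma>(1)] by blast
  then have less: "\<gamma> * (u \<bullet> b) < v \<bullet> a" by simp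
  have ub: "0 \<le> u \<bullet> b"
    using m assms(1) by (intro inner_nonneg_vec) (auto simp: supporting_multiplier_def)
  have "v \<bullet> a \<le> \<psi> * (u \<bullet> b)"
    using supporting_multiplier_production_cone[OF m \<psi>] by simp
  then have "0 < u \<bullet> b" using ub less by (cases "u \<bullet> b = 0") auto
  moreover have "0 < v \<bullet> a"
    using less mult_nonneg_nonneg[OF \<gamma>(2) ub] by linarith
  then have "0 < v \<bullet> X0"
    using m X0 by (intro inner_nonneg_pos_weights) (auto simp: supporting_multiplier_def)
  ultimately show ?thesis using that m less by blast
qed

text \<open>Here the separating multiplier may have \<open>v = 0\<close>. A given multiplier with \<open>v' \<bullet> X0 > 0\<close> is
  mixed in with a weight that does not use up the slack in the strict inequality.\<close>

lemma multiplier_ratio_below: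
  assumes a: "\<And>i. 0 \<le> a $ i" and b: "\<And>r. 0 \<le> b $ r" and X0: "\<And>i. 0 < X0 $ i"
    and \<beta>: "(a, \<beta> *\<^sub>R b) \<notin> production_cone X Y X0 Y0" "0 \<le> \<beta>"
    and m': "supporting_multiplier X Y X0 Y0 v' u'" "0 < v' \<bullet> X0"
  obtains v u where "supporting_multiplier X Y X0 Y0 v u" "0 < u \<bullet> b" "0 < v \<bullet> X0"
    "v \<bullet> a < \<beta> * (u \<bullet> b)"
proof -
  obtain v u where m: "supporting_multiplier X Y X0 Y0 v u" and "v \<bullet> a < u \<bullet> (\<beta> *\<^sub>R b)"
    using supporting_multiplier_separates[OF \<beta>(1)] by blast
  then have less: "v \<bullet> a < \<beta> * (u \<bullet> b)" by simp
  have nonneg: "0 \<le> v \<bullet> a" "0 \<le> u \<bullet> b" "0 \<le> v \<bullet> X0" "0 \<le> v' \<bullet> a" "0 \<le> u' \<bullet> b"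
    using m m'(1) a b X0 by (auto simp: supporting_multiplier_def less_imp_le intro!: inner_nonneg_vec)
  have ub: "0 < u \<bullet> b"
    using less nonneg by (cases "u \<bullet> b = 0") auto
  \<comment> \<open>Small enough for the mixture to keep the strict inequality.\<close>
  define c where "c = (\<beta> * (u \<bullet> b) - v \<bullet> a) / (v' \<bullet> a + 1)"
  have c: "0 < c" using less nonneg by (simp add: c_def)
  have "c * (v' \<bullet> a) < c * (v' \<bullet> a + 1)" using c by simp
  also have "\<dots> = \<beta> * (u \<bullet> b) - v \<bullet> a"
    using nonneg by (simp add: c_def)
  finally have "v \<bullet> a + c * (v' \<bullet> a) < \<beta> * (u \<bullet> b)" by simp
  also have "\<dots> \<le> \<beta> * (u \<bullet> b + c * (u' \<bullet> b))"
    using c nonneg \<beta>(2) by (intro mult_left_mono) auto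
  finally have "(v + c *\<^sub>R v') \<bullet> a < \<beta> * ((u + c *\<^sub>R u') \<bullet> b)"
    by (simp add: inner_add_left)
  moreover have "supporting_multiplier X Y X0 Y0 (v + c *\<^sub>R v') (u + c *\<^sub>R u')"
    using supporting_multiplier_combination[OF m m'(1), of 1 c] c by simp
  moreover have "0 < (u + c *\<^sub>R u') \<bullet> b" "0 < (v + c *\<^sub>R v') \<bullet> X0"
    using ub c nonneg m'(2) by (simp_all add: inner_add_left add_pos_nonneg add_nonneg_pos)
  ultimately show ?thesis using that by blast
qed

lemma rho_eq_slopes:
  fixes X0 \<omega> :: "real^'m::finite" and Y0 \<delta> :: "real^'s::finite"
    and X :: "'n::finite \<Rightarrow> real^'m" and Y :: "'n \<Rightarrow> real^'s"
  defines "a \<equiv> (\<chi> i. \<omega> $ i * X0 $ i)" and "b \<equiv> (\<chi> r. \<delta> $ r * Y0 $ r)"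
  assumes a: "\<And>i. 0 \<le> a $ i" and b: "\<And>r. 0 \<le> b $ r" and X0: "\<And>i. 0 < X0 $ i"
    and \<xi>: "is_maximum {\<beta>. (a, \<beta> *\<^sub>R b) \<in> production_cone X Y X0 Y0} \<xi>" "0 \<le> \<xi>"
    and \<psi>: "is_minimum {\<gamma>. (- a, - (\<gamma> *\<^sub>R b)) \<in> production_cone X Y X0 Y0} \<psi>" "0 < \<psi>"
  shows "rho_upper X Y \<omega> \<delta> X0 Y0 = ereal \<psi>" "rho_lower X Y \<omega> \<delta> X0 Y0 = ereal \<xi>"
proof -
  let ?C = "production_cone X Y X0 Y0"
  let ?M = "supporting_multiplier X Y X0 Y0"
  let ?Q = "multiplier_ratios X Y \<omega> \<delta> X0 Y0"
  have in_C: "(a, \<xi> *\<^sub>R b) \<in> ?C" "(- a, - (\<psi> *\<^sub>R b)) \<in> ?C"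
    using \<xi>(1) \<psi>(1) by (simp_all add: is_maximum_def is_minimum_def)
  have ratioI: "v \<bullet> a / (u \<bullet> b) \<in> ?Q" if "?M v u" "0 < u \<bullet> b" "0 < v \<bullet> X0" for v u
    unfolding multiplier_ratios_supporting a_def[symmetric] b_def[symmetric]
    using that by force
  have bounds: "\<xi> \<le> q \<and> q \<le> \<psi>" if "q \<in> ?Q" for q
  proof -
    obtain v u where q: "q = v \<bullet> a / (u \<bullet> b)" "?M v u" "u \<bullet> b \<noteq> 0"
      using \<open>q \<in> ?Q\<close> unfolding multiplier_ratios_supporting a_def[symmetric] b_def[symmetric] by blast
    have "0 \<le> u \<bullet> b"
      using q(2) b by (intro inner_nonneg_vec) (auto simp: supporting_multiplier_def)
    then have "0 < u \<bullet> b" using q(3) by simp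
    moreover have "\<xi> * (u \<bullet> b) \<le> v \<bullet> a" "v \<bullet> a \<le> \<psi> * (u \<bullet> b)"
      using in_C[THEN supporting_multiplier_production_cone[OF q(2)]] by simp_all
    ultimately show ?thesis by (simp add: q(1) field_simps)
  qed
  have above: "\<exists>v u. ?M v u \<and> 0 < u \<bullet> b \<and> 0 < v \<bullet> X0 \<and> \<gamma> * (u \<bullet> b) < v \<bullet> a"
    if "0 \<le> \<gamma>" "\<gamma> < \<psi>" for \<gamma>
  proof -
    have "(- a, - (\<gamma> *\<^sub>R b)) \<notin> ?C" using \<psi>(1) that by (force simp: is_minimum_def)
    then show ?thesis using multiplier_ratio_above[OF b X0 in_C(2) _ that(1)] by blast
  qed
  have below: "\<exists>v u. ?M v u \<and> 0 < u \<bullet> b \<and> 0 < v \<bullet> X0 \<and> v \<bullet> a < \<beta> * (u \<bullet> b)"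
    if "\<xi> < \<beta>" for \<beta>
  proof -
    have "(a, \<beta> *\<^sub>R b) \<notin> ?C" using \<xi>(1) that by (force simp: is_maximum_def)
    moreover have "0 \<le> \<beta>" using that \<xi>(2) by simp
    \<comment> \<open>Any slope in \<open>[0, \<psi>)\<close> yields a normalisable multiplier to mix in.\<close>
    moreover obtain v' u' where "?M v' u'" "0 < v' \<bullet> X0"
      using above[of 0] \<psi>(2) by auto
    ultimately show ?thesis
      using multiplier_ratio_below[OF a b X0] by blast
  qed
  show "rho_upper X Y \<omega> \<delta> X0 Y0 = ereal \<psi>"
    unfolding rho_upper_def
  proof (rule SUP_eqI)
    fix y assume y: "\<And>q. q \<in> ?Q \<Longrightarrow> ereal q \<le> y"
    show "ereal \<psi> \<le> y"
    proof (rule ccontr)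
      assume "\<not> ereal \<psi> \<le> y"
      then have "y < ereal \<psi>" by simp
      then obtain \<gamma> where \<gamma>: "y < ereal \<gamma>" "\<gamma> < \<psi>"
        using ereal_dense2[of y "ereal \<psi>"] by auto
      \<comment> \<open>The supremum may be compared with a negative \<open>y\<close>, whereas separation is available only for
        nonnegative slopes.\<close>
      obtain v u where vu: "?M v u" "0 < u \<bullet> b" "0 < v \<bullet> X0" "max 0 \<gamma> * (u \<bullet> b) < v \<bullet> a"
        using above[of "max 0 \<gamma>"] \<gamma>(2) \<psi>(2) by auto
      then have "max 0 \<gamma> < v \<bullet> a / (u \<bullet> b)" by (simp only: pos_less_divide_eq)
      then have "ereal \<gamma> \<le> ereal (v \<bullet> a / (u \<bullet> b))" by simp
      then show False using y[OF ratioI[OF vu(1-3)]] \<gamma>(1) by (meson leD order_trans)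
    qed
  qed (use bounds in simp)
  show "rho_lower X Y \<omega> \<delta> X0 Y0 = ereal \<xi>"
    unfolding rho_lower_def
  proof (rule INF_eqI)
    fix y assume y: "\<And>q. q \<in> ?Q \<Longrightarrow> y \<le> ereal q"
    show "y \<le> ereal \<xi>"
    proof (rule ccontr)
      assume "\<not> y \<le> ereal \<xi>"
      then have "ereal \<xi> < y" by simp
      then obtain \<beta> where \<beta>: "\<xi> < \<beta>" "ereal \<beta> < y"
        using ereal_dense2[of "ereal \<xi>" y] by auto
      obtain v u where vu: "?M v u" "0 < u \<bullet> b" "0 < v \<bullet> X0" "v \<bullet> a < \<beta> * (u \<bullet> b)"
        using below[OF \<beta>(1)] by auto
      then have "v \<bullet> a / (u \<bullet> b) < \<beta>" by (simp add: field_simps)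
      then have "ereal (v \<bullet> a / (u \<bullet> b)) \<le> ereal \<beta>" by simp
      then show False using y[OF ratioI[OF vu(1-3)]] \<beta>(2) by (meson leD order_trans)
    qed
  qed (use bounds in simp)
qed

section \<open>One-sided scale problems and slopes\<close>

lemma xi_values_PPS:
  "xi_values X Y \<omega> \<delta> X0 Y0 t = {\<beta> / t | \<beta>.
     (X0 + t *\<^sub>R (\<chi> i. \<omega> $ i * X0 $ i), Y0 + \<beta> *\<^sub>R (\<chi> r. \<delta> $ r * Y0 $ r)) \<in> PPS X Y}"
  unfolding xi_values_def PPS_def by (auto simp: less_eq_vec_def algebra_simps)

lemma psi_values_PPS:
  "psi_values X Y \<omega> \<delta> X0 Y0 t = {\<beta> / t | \<beta>.
     (X0 - t *\<^sub>R (\<chi> i. \<omega> $ i * X0 $ i), Y0 - \<beta> *\<^sub>R (\<chi> r. \<delta> $ r * Y0 $ r)) \<in> PPS X Y}"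
  unfolding psi_values_def PPS_def by (auto simp: less_eq_vec_def algebra_simps)

lemma scaling_mult_vec:
  "scaling d t *v x = x + t *\<^sub>R (\<chi> i. d $ i * x $ i)"
proof -
  have "(\<Sum>j\<in>UNIV. (if i = j then 1 + d $ i * t else 0) * x $ j) = x $ i + t * (d $ i * x $ i)" for i
  proof -
    have "(\<Sum>j\<in>UNIV. (if i = j then 1 + d $ i * t else 0) * x $ j)
        = (\<Sum>j\<in>UNIV. if i = j then (1 + d $ i * t) * x $ j else 0)"
      by (intro sum.cong) auto
    then show ?thesis by (simp add: algebra_simps)
  qed
  then show ?thesis
    by (simp add: vec_eq_iff scaling_def diag_def matrix_vector_mult_def cong: if_cong)
qed

text \<open>Members of the cone are feasible for short steps, which gives attainment; feasible points have
  displacements in the cone, which gives optimality for every \<open>t > 0\<close>. The same holds for \<open>\<psi>\<close>.\<close>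

lemma eventually_xi_maximum:
  fixes X0 \<omega> :: "real^'m::finite" and Y0 \<delta> :: "real^'s::finite"
    and X :: "'n::finite \<Rightarrow> real^'m" and Y :: "'n \<Rightarrow> real^'s"
  assumes z: "(X0, Y0) \<in> PPS X Y"
    and \<xi>: "is_maximum {\<beta>. ((\<chi> i. \<omega> $ i * X0 $ i), \<beta> *\<^sub>R (\<chi> r. \<delta> $ r * Y0 $ r)) \<in> production_cone X Y X0 Y0} \<xi>"
  shows "\<forall>\<^sub>F t in at_right 0. is_maximum (xi_values X Y \<omega> \<delta> X0 Y0 t) \<xi>"
proof -
  define a where "a = (\<chi> i. \<omega> $ i * X0 $ i)"
  define b where "b = (\<chi> r. \<delta> $ r * Y0 $ r)"
  let ?C = "production_cone X Y X0 Y0"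
  have in_C: "(a, \<xi> *\<^sub>R b) \<in> ?C" and max: "\<And>\<beta>. (a, \<beta> *\<^sub>R b) \<in> ?C \<Longrightarrow> \<beta> \<le> \<xi>"
    using \<xi> by (simp_all add: is_maximum_def a_def b_def)
  obtain e where e: "e > 0" "\<And>t. 0 \<le> t \<Longrightarrow> t \<le> e \<Longrightarrow> (X0, Y0) + t *\<^sub>R (a, \<xi> *\<^sub>R b) \<in> PPS X Y"
    using production_cone_feasible[OF z in_C] by blast
  have "is_maximum (xi_values X Y \<omega> \<delta> X0 Y0 t) \<xi>" if t: "0 < t" "t < e" for t
    unfolding is_maximum_def xi_values_PPS a_def[symmetric] b_def[symmetric]
  proof (intro conjI ballI)
    show "\<xi> \<in> {\<beta> / t |\<beta>. (X0 + t *\<^sub>R a, Y0 + \<beta> *\<^sub>R b) \<in> PPS X Y}"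
      using e(2)[of t] t by (auto intro!: exI[of _ "t * \<xi>"])
  next
    fix q assume "q \<in> {\<beta> / t |\<beta>. (X0 + t *\<^sub>R a, Y0 + \<beta> *\<^sub>R b) \<in> PPS X Y}"
    then obtain \<beta> where q: "q = \<beta> / t" "(X0 + t *\<^sub>R a, Y0 + \<beta> *\<^sub>R b) \<in> PPS X Y" by blast
    have "(t *\<^sub>R a, \<beta> *\<^sub>R b) \<in> ?C"
      using PPS_displacement_in_production_cone[OF q(2), of X0 Y0] by simp
    then have "(1 / t) *\<^sub>R (t *\<^sub>R a, \<beta> *\<^sub>R b) \<in> ?C"
      using t by (intro convex_cone_scaleR convex_cone_production_cone) auto
    then show "q \<le> \<xi>" using t q(1) by (intro max) simp
  qed
  then show ?thesis
    using e(1) unfolding eventually_at_right_field by blast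
qed

lemma eventually_psi_minimum:
  fixes X0 \<omega> :: "real^'m::finite" and Y0 \<delta> :: "real^'s::finite"
    and X :: "'n::finite \<Rightarrow> real^'m" and Y :: "'n \<Rightarrow> real^'s"
  assumes z: "(X0, Y0) \<in> PPS X Y"
    and \<psi>: "is_minimum {\<gamma>. (- (\<chi> i. \<omega> $ i * X0 $ i), - (\<gamma> *\<^sub>R (\<chi> r. \<delta> $ r * Y0 $ r)))
      \<in> production_cone X Y X0 Y0} \<psi>"
  shows "\<forall>\<^sub>F t in at_right 0. is_minimum (psi_values X Y \<omega> \<delta> X0 Y0 t) \<psi>"
proof -
  define a where "a = (\<chi> i. \<omega> $ i * X0 $ i)"
  define b where "b = (\<chi> r. \<delta> $ r * Y0 $ r)"
  let ?C = "production_cone X Y X0 Y0"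
  have in_C: "(- a, - (\<psi> *\<^sub>R b)) \<in> ?C" and min: "\<And>\<gamma>. (- a, - (\<gamma> *\<^sub>R b)) \<in> ?C \<Longrightarrow> \<psi> \<le> \<gamma>"
    using \<psi> by (simp_all add: is_minimum_def a_def b_def)
  obtain e where e: "e > 0" "\<And>t. 0 \<le> t \<Longrightarrow> t \<le> e \<Longrightarrow> (X0, Y0) + t *\<^sub>R (- a, - (\<psi> *\<^sub>R b)) \<in> PPS X Y"
    using production_cone_feasible[OF z in_C] by blast
  have "is_minimum (psi_values X Y \<omega> \<delta> X0 Y0 t) \<psi>" if t: "0 < t" "t < e" for t
    unfolding is_minimum_def psi_values_PPS a_def[symmetric] b_def[symmetric]
  proof (intro conjI ballI)
    show "\<psi> \<in> {\<beta> / t |\<beta>. (X0 - t *\<^sub>R a, Y0 - \<beta> *\<^sub>R b) \<in> PPS X Y}"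
      using e(2)[of t] t by (auto intro!: exI[of _ "t * \<psi>"])
  next
    fix q assume "q \<in> {\<beta> / t |\<beta>. (X0 - t *\<^sub>R a, Y0 - \<beta> *\<^sub>R b) \<in> PPS X Y}"
    then obtain \<beta> where q: "q = \<beta> / t" "(X0 - t *\<^sub>R a, Y0 - \<beta> *\<^sub>R b) \<in> PPS X Y" by blast
    have "(- (t *\<^sub>R a), - (\<beta> *\<^sub>R b)) \<in> ?C"
      using PPS_displacement_in_production_cone[OF q(2), of X0 Y0] by simp
    then have "(1 / t) *\<^sub>R (- (t *\<^sub>R a), - (\<beta> *\<^sub>R b)) \<in> ?C"
      using t by (intro convex_cone_scaleR convex_cone_production_cone) auto
    then show "\<psi> \<le> q" using t q(1) by (intro min) simp
  qed
  then show ?thesis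
    using e(1) unfolding eventually_at_right_field by blast
qed

theorem theorem6:
  fixes X :: "'n::finite \<Rightarrow> real^'m::finite" and Y :: "'n \<Rightarrow> real^'s::finite"
    and X0 \<omega> :: "real^'m" and Y0 \<delta> :: "real^'s"
  assumes "\<forall>j i. X j $ i \<ge> 0" and "\<forall>j r. Y j $ r \<ge> 0"
    and "(X0, Y0) \<in> PPS X Y"
    and "strongly_efficient X Y X0 Y0"
    and "\<forall>i. X0 $ i > 0" and "\<forall>r. Y0 $ r > 0"
    and "\<forall>i. \<omega> $ i \<ge> 0" and "(\<Sum>i\<in>UNIV. \<omega> $ i) = real CARD('m)"
    and "\<forall>r. \<delta> $ r \<ge> 0" and "(\<Sum>r\<in>UNIV. \<delta> $ r) = real CARD('s)"
    and "\<not> directional_smallest_scale_size X Y \<omega> \<delta> X0 Y0"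
  shows "\<forall>\<^sub>F t in at_right 0. \<exists>\<psi> \<xi>.
    is_minimum (psi_values X Y \<omega> \<delta> X0 Y0 t) \<psi> \<and>
    is_maximum (xi_values X Y \<omega> \<delta> X0 Y0 t) \<xi> \<and>
    rho_upper X Y \<omega> \<delta> X0 Y0 = ereal \<psi> \<and>
    rho_lower X Y \<omega> \<delta> X0 Y0 = ereal \<xi>"
proof -
  define a where "a = (\<chi> i. \<omega> $ i * X0 $ i)"
  define b where "b = (\<chi> r. \<delta> $ r * Y0 $ r)"
  let ?C = "production_cone X Y X0 Y0"
  have nonneg: "0 \<le> a $ i" "0 \<le> b $ r" for i r
    using assms(5-7,9) by (simp_all add: a_def b_def less_imp_le)
  \<comment> \<open>The weights have positive sums.\<close>
  have "\<omega> \<noteq> 0" "\<delta> \<noteq> 0"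
    using assms(8,10) by auto
  then have nonzero: "a \<noteq> 0" "b \<noteq> 0"
    using assms(5,6) unfolding a_def b_def vec_eq_iff
    by (metis less_irrefl mult_eq_0_iff vec_lambda_beta zero_index)+
  have eff: "t = 0 \<and> \<beta> = 0" if "(t *\<^sub>R a, \<beta> *\<^sub>R b) \<in> ?C" "t \<le> 0" "0 \<le> \<beta>" for t \<beta>
    using efficient_no_improving_direction[OF assms(4) that(1)] that(2,3) nonneg nonzero
    by (auto simp: less_eq_vec_def mult_nonpos_nonneg)
  have right: "(a, 0) \<in> ?C"
    using free_disposal_in_production_cone[of a 0 X Y X0 Y0] nonneg by simp
  obtain \<beta>0 t0 where t0: "t0 < 0" "(scaling \<omega> t0 *v X0, scaling \<delta> \<beta>0 *v Y0) \<in> PPS X Y"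
    using assms(4,11) unfolding directional_smallest_scale_size_def by blast
  then have "(t0 *\<^sub>R a, \<beta>0 *\<^sub>R b) \<in> ?C"
    using PPS_displacement_in_production_cone[OF t0(2), of X0 Y0]
    by (simp add: scaling_mult_vec a_def b_def)
  \<comment> \<open>Normalise the contraction of the inputs to step length one.\<close>
  then have "(- 1 / t0) *\<^sub>R (t0 *\<^sub>R a, \<beta>0 *\<^sub>R b) \<in> ?C"
    using t0(1) by (intro convex_cone_scaleR convex_cone_production_cone) (auto simp: divide_nonpos_neg)
  then have left: "(- a, - ((\<beta>0 / t0) *\<^sub>R b)) \<in> ?C"
    using t0(1) by simp
  obtain \<xi> \<psi> where slopes: "is_maximum {\<beta>. (a, \<beta> *\<^sub>R b) \<in> ?C} \<xi>"
    "is_minimum {\<gamma>. (- a, - (\<gamma> *\<^sub>R b)) \<in> ?C} \<psi>" "0 \<le> \<xi>" "0 < \<psi>"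
    using boundary_slopes_exist[OF convex_cone_production_cone closed_production_cone right left eff]
    by blast
  have "rho_upper X Y \<omega> \<delta> X0 Y0 = ereal \<psi>" "rho_lower X Y \<omega> \<delta> X0 Y0 = ereal \<xi>"
    using rho_eq_slopes nonneg assms(5) slopes unfolding a_def b_def by blast+
  moreover have "\<forall>\<^sub>F t in at_right 0. is_maximum (xi_values X Y \<omega> \<delta> X0 Y0 t) \<xi>"
    "\<forall>\<^sub>F t in at_right 0. is_minimum (psi_values X Y \<omega> \<delta> X0 Y0 t) \<psi>"
    using eventually_xi_maximum[OF assms(3)] eventually_psi_minimum[OF assms(3)] slopes(1,2)
    unfolding a_def b_def by blast+
  ultimately show ?thesis
    by (auto elim: eventually_elim2)
qed

end
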